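(* Let $t$ be a positive integer and $0\le k\le t-1$. For every partition $\lambda$ whose $t$-core is the empty partition, $$\sum_{\substack{\square\in\lambda\\ h_\square\equiv k \ (\mathrm{mod}\ t)}}h_\square^2+\sum_{\substack{\square\in\lambda\\ h_\square\equiv t-k\ (\mathrm{mod}\ t)}}h_\square^2-\Biggl(\sum_{\substack{\square\in\lambda\\ c_\square\equiv k\ (\mathrm{mod}\ t)}}c_\square^2+\sum_{\substack{\square\in\lambda\\ c_\square\equiv t-k\ (\mathrm{mod}\ t)}}c_\square^2\Biggr)=2t^2\Bigl(\sum_{i=0}^{t-1-k}n_in_{i+k}+\sum_{i=0}^{k-1}n_in_{i+t-k}\Bigr),$$ where $n_i=|\lambda^i|$ is the size of the $i$-th $t$-quotient of $\lambda$.
   Context: Partitions are identified with Young diagrams; the content of box $(i,j)$ (row $i$, column $j$) is $c_\square=j-i$, and $h_\square$ is its hook length (boxes to its right in its row, plus below it in its column, plus one). The 01-sequence $(z_i)_{i\in\mathbb Z}$ of $\lambda$: traverse the boundary of the Young diagram from the bottom (infinite vertical ray below the first column) to the right (infinite horizontal ray right of the first row), labelling vertical edges $0$ and horizontal edges $1$, indexed so that $\#\{i\ge0:z_i=0\}=\#\{i<0:z_i=1\}$. Adding (resp. removing) a $t$-hook means exchanging $z_i=0,z_{i+t}=1$ into $1,0$ (resp. the reverse). The $t$-core of $\lambda$ is obtained by removing $t$-hooks until impossible (independent of choices). For $0\le i\le t-1$ the $i$-th $t$-quotient $\lambda^i$ is the partition whose 01-sequence is the subsequence $(z_{tj+i})_{j\in\mathbb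 Z}$ (the partition determined by a 01-sequence does not depend on shifting indices). *)

theory Defs
  imports Complex_Main "HOL-Number_Theory.Cong"
begin

definition is_int_partition :: "nat list \<Rightarrow> bool" where
  "is_int_partition lam \<longleftrightarrow> sorted_wrt (\<ge>) lam \<and> 0 \<notin> set lam"

definition row_length :: "nat list \<Rightarrow> nat \<Rightarrow> nat" where
  "row_length lam r = (if r < length lam then lam ! r else 0)"

(* Boxes are (row, column) pairs, numbered from 0; contents do not change under
   this shift of both coordinates. *)
definition young_diagram :: "nat list \<Rightarrow> (nat \<times> nat) set" where
  "young_diagram lam = {(i, j). i < length lam \<and> j < lam ! i}"

definition box_content :: "nat \<times> nat \<Rightarrow> int" where
  "box_content b = int (snd b) - int (fst b)"

definition hook_length :: "nat list \<Rightarrow> nat \<times> nat \<Rightarrow> nat" where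
  "hook_length lam b =
     card {j'. snd b < j' \<and> (fst b, j') \<in> young_diagram lam} +
     card {i'. fst b < i' \<and> (i', snd b) \<in> young_diagram lam} + 1"

(* Use coordinates (x, y) with x to the right and y downwards.  Along the boundary,
   traversed from the bottom to the right, x - y increases by one with every edge, and
   the edge starting at (x, y) gets index x - y.  Writing l for the length of row r (0 for
   the empty rows below the diagram), the vertical edge at the end of row r runs from
   (l, r + 1) to (l, r); all other edges are horizontal.  By zero_one_balanced this is
   the indexing with #{i >= 0. z_i = 0} = #{i < 0. z_i = 1}. *)
definition zero_one :: "nat list \<Rightarrow> int \<Rightarrow> nat" where
  "zero_one lam m = (if \<exists>r. m = int (row_length lam r) - int r - 1 then 0 else 1)"

definition remove_hook :: "nat \<Rightarrow> nat list \<Rightarrow> nat list \<Rightarrow> bool" where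
  "remove_hook t lam \<mu> \<longleftrightarrow> is_int_partition lam \<and> is_int_partition \<mu> \<and>
     (\<exists>i. zero_one lam i = 1 \<and> zero_one lam (i + int t) = 0 \<and>
          zero_one \<mu> = (zero_one lam)(i := 0, i + int t := 1))"

definition is_t_core_of :: "nat \<Rightarrow> nat list \<Rightarrow> nat list \<Rightarrow> bool" where
  "is_t_core_of t \<mu> lam \<longleftrightarrow> (remove_hook t)\<^sup>*\<^sup>* lam \<mu> \<and> (\<nexists>\<nu>. remove_hook t \<mu> \<nu>)"

(* The subsequence need not be balanced, hence the shift s. *)
definition t_quotient :: "nat \<Rightarrow> nat list \<Rightarrow> nat \<Rightarrow> nat list" where
  "t_quotient t lam i = (THE \<mu>. is_int_partition \<mu> \<and>
     (\<exists>s. \<forall>j. zero_one \<mu> (j + s) = zero_one lam (int t * j + int i)))"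

lemma row_length_antimono:
  assumes "is_int_partition lam" "r \<le> s"
  shows "row_length lam s \<le> row_length lam r"
  using assms unfolding is_int_partition_def row_length_def
  by (auto simp: sorted_wrt_iff_nth_less le_less)

lemma zero_one_balanced:
  assumes "is_int_partition lam"
  shows "finite {i. i \<ge> 0 \<and> zero_one lam i = 0}" (is "finite ?Z")
    and "finite {i. i < 0 \<and> zero_one lam i = 1}" (is "finite ?O")
    and "card {i. i \<ge> 0 \<and> zero_one lam i = 0} = card {i. i < 0 \<and> zero_one lam i = 1}"
proof -
  define N where "N = length lam"
  define e where "e r = int (row_length lam r) - int r - 1" for r
  define V where "V = e ` {..<N}"
  have mono: "e s < e r" if "r < s" for r s
    using row_length_antimono[OF assms, of r s] that by (simp add: e_def)
  have inj: "inj_on e {..<N}"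
    by (rule inj_onI) (metis mono less_irrefl nat_neq_iff)
  have cV: "card V = N" and fV: "finite V"
    by (simp_all add: V_def card_image inj)
  have big: "e r = - int r - 1" if "r \<ge> N" for r
    using that by (simp add: e_def row_length_def N_def)
  have lo: "- int N \<le> m" if "m \<in> V" for m
    using that by (auto simp: V_def e_def)
  have zero: "zero_one lam m = 0 \<longleftrightarrow> m \<in> V" if "m \<ge> - int N" for m
  proof -
    have "(\<exists>r. m = e r) \<longleftrightarrow> m \<in> V"
    proof
      assume "\<exists>r. m = e r"
      then obtain r where r: "m = e r" by blast
      have "r < N" using big[of r] that r by (cases "r < N") auto
      with r show "m \<in> V" by (auto simp: V_def)
    qed (auto simp: V_def)
    then show ?thesis by (simp add: zero_one_def e_def)
  qed
  have low: "zero_one lam m = 0" if "m < - int N" for m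
  proof -
    have "m = e (nat (- m - 1))" using that big[of "nat (- m - 1)"] by simp
    then show ?thesis unfolding zero_one_def e_def by (metis (lifting))
  qed
  have Z: "?Z = V \<inter> {0..}" using zero by auto
  have one: "zero_one lam m = 1 \<longleftrightarrow> zero_one lam m \<noteq> 0" for m
    by (simp add: zero_one_def)
  have O: "?O = {- int N..<0} - V"
  proof (rule set_eqI)
    fix m
    show "m \<in> ?O \<longleftrightarrow> m \<in> {- int N..<0} - V"
      using zero[of m] low[of m] one[of m] by (cases "m < - int N") auto
  qed
  show "finite ?Z" "finite ?O" unfolding Z O using fV by auto
  have "card ?O = N - card (V \<inter> {..<0})"
  proof -
    have "{- int N..<0} - V = {- int N..<0} - (V \<inter> {..<0})" by auto
    moreover have "V \<inter> {..<0} \<subseteq> {- int N..<0}" using lo by auto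
    ultimately show ?thesis unfolding O
      by (simp add: card_Diff_subset fV)
  qed
  moreover have "card V = card (V \<inter> {0..}) + card (V \<inter> {..<0})"
  proof -
    have "V = (V \<inter> {0..}) \<union> (V \<inter> {..<0})" by auto
    moreover have "(V \<inter> {0..}) \<inter> (V \<inter> {..<0}) = {}" by auto
    ultimately show ?thesis
      using card_Un_disjoint[of "V \<inter> {0..}" "V \<inter> {..<0}"] fV by simp
  qed
  ultimately show "card ?Z = card ?O" unfolding Z using cV by simp
qed

end

theory Submission
  imports Defs
begin

text \<open>
  Record a partition by its beta set \<open>X\<close> of size \<open>N\<close>, the shifted positions of the zeros of its
  01-sequence, and let \<open>Y = {0, \<dots>, N - 1}\<close> be the beta set of the empty partition. For an even
  function \<open>F\<close> with \<open>F 0 = 0\<close>, the difference of the sums of \<open>F\<close> over hook lengths and over contents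
  equals \<open>- 1/2\<close> times the sum of \<open>\<mu>(x) \<mu>(y) F(x - y)\<close>, where \<open>\<mu>\<close> is the indicator function of \<open>X\<close>
  minus that of \<open>Y\<close>. Choose \<open>N\<close> divisible by \<open>t\<close> and take for \<open>F\<close> the square, restricted to the
  residues \<open>k\<close> and \<open>- k\<close> modulo \<open>t\<close>. Since the \<open>t\<close>-core is empty, \<open>\<mu>\<close> has total mass \<open>0\<close> on each
  residue class, so in \<open>(x - y)\<^sup>2\<close> only the mixed term \<open>- 2 x y\<close> survives, and the first moment of
  \<open>\<mu>\<close> on the class of \<open>i\<close> is \<open>t n\<^sub>i\<close>.
\<close>

section \<open>Beta sets and the zeros of the 01-sequence\<close>

text \<open>For \<open>length lam \<le> N\<close> these are the zeros at indices from
  \<open>- int N\<close> on, shifted by \<open>N\<close>. Empty rows pad the diagram, so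
  \<open>N\<close> can be any large enough multiple of \<open>t\<close>.\<close>

definition beta :: "nat list \<Rightarrow> nat \<Rightarrow> int set" where
  "beta lam N = (\<lambda>r. int N + int (row_length lam r) - int r - 1) ` {..<N}"

lemma row_length_strict:
  assumes "is_int_partition lam" "r < s"
  shows "int (row_length lam s) - int s < int (row_length lam r) - int r"
  using row_length_antimono[OF assms(1), of r s] assms(2) by simp

lemma inj_on_beta:
  assumes "is_int_partition lam"
  shows "inj_on (\<lambda>r. int N + int (row_length lam r) - int r - 1) A"
proof (rule inj_onI)
  fix r s assume "int N + int (row_length lam r) - int r - 1 = int N + int (row_length lam s) - int s - 1"
  then show "r = s"
    using row_length_strict[OF assms, of r s] row_length_strict[OF assms, of s r]
    by (cases r s rule: linorder_cases) auto
qed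

lemma finite_beta [simp]: "finite (beta lam N)"
  by (simp add: beta_def)

lemma sum_beta:
  assumes "is_int_partition lam"
  shows "(\<Sum>x\<in>beta lam N. g x) = (\<Sum>r<N. g (int N + int (row_length lam r) - int r - 1))"
  unfolding beta_def by (subst sum.reindex[OF inj_on_beta[OF assms]]) simp

lemma row_length_beyond: "length lam \<le> r \<Longrightarrow> row_length lam r = 0"
  by (simp add: row_length_def)

lemma beta_nonneg: "x \<in> beta lam N \<Longrightarrow> 0 \<le> x"
  by (auto simp: beta_def)

text \<open>The rows from \<open>N\<close> on are empty and their edges fill all indices below
  \<open>- int N\<close>; the first \<open>N\<close> rows give the beta set.\<close>

lemma zero_one_eq_0_iff:
  assumes "length lam \<le> N"
  shows "zero_one lam m = 0 \<longleftrightarrow> m < - int N \<or> m + int N \<in> beta lam N"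
proof
  assume "zero_one lam m = 0"
  then obtain r where r: "m = int (row_length lam r) - int r - 1"
    by (auto simp: zero_one_def split: if_splits)
  show "m < - int N \<or> m + int N \<in> beta lam N"
  proof (cases "r < N")
    case True
    then show ?thesis using r by (auto simp: beta_def)
  next
    case False
    then show ?thesis using r row_length_beyond[of lam r] assms by simp
  qed
next
  assume *: "m < - int N \<or> m + int N \<in> beta lam N"
  have "\<exists>r. m = int (row_length lam r) - int r - 1"
  proof (cases "m < - int N")
    case True
    then have "length lam \<le> nat (- m - 1)" using assms by linarith
    with True show ?thesis
      by (intro exI[of _ "nat (- m - 1)"]) (simp add: row_length_beyond)
  next
    case False
    with * show ?thesis by (auto simp: beta_def)
  qed
  then show "zero_one lam m = 0" by (simp add: zero_one_def)
qed

lemma sum_list_eq_sum_row_length: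
  assumes "length lam \<le> N"
  shows "sum_list lam = (\<Sum>r<N. row_length lam r)"
proof -
  have "sum_list lam = (\<Sum>r<length lam. row_length lam r)"
    by (simp add: sum_list_sum_nth atLeast0LessThan row_length_def)
  also have "\<dots> = (\<Sum>r<N. row_length lam r)"
    using assms by (intro sum.mono_neutral_left) (auto simp: row_length_beyond)
  finally show ?thesis .
qed

lemma sum_lessThan_int: "(\<Sum>y\<in>{0..<int N}. g y) = (\<Sum>r<N. g (int r))"
  by (rule sum.reindex_bij_witness[of _ int nat]) auto

lemma sum_lessThan_int_rev: "(\<Sum>y\<in>{0..<int N}. g y) = (\<Sum>r<N. g (int N - int r - 1))"
  by (rule sum.reindex_bij_witness[of _ "\<lambda>r. int N - int r - 1" "\<lambda>y. nat (int N - y - 1)"]) auto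

text \<open>Row \<open>r\<close> pushes the element \<open>int N - int r - 1\<close> of the empty
  partition's beta set up by its own length, so the size is a difference of first moments.\<close>

lemma sum_beta_eq_size:
  assumes "is_int_partition lam" "length lam \<le> N"
  shows "\<Sum>(beta lam N) = int (sum_list lam) + \<Sum>{0..<int N}"
  unfolding sum_beta[OF assms(1)] sum_lessThan_int_rev sum_list_eq_sum_row_length[OF assms(2)]
  unfolding of_nat_sum sum.distrib[symmetric] by (rule sum.cong) simp_all

section \<open>Reconstruction of partitions from beta sets and 01-sequences\<close>

lemma row_length_Cons [simp]:
  "row_length (a # lam) 0 = a" "row_length (a # lam) (Suc r) = row_length lam r"
  by (simp_all add: row_length_def)

text \<open>Dropping the first row lowers every row index by one, which the change from
  \<open>Suc M\<close> to \<open>M\<close> compensates. Stated through row lengths, this covers the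
  pair \<open>[]\<close>, \<open>[]\<close> as well as \<open>a # mu\<close>,
  \<open>mu\<close>.\<close>

lemma beta_Suc:
  assumes "\<And>r. row_length lam (Suc r) = row_length mu r"
  shows "beta lam (Suc M) = insert (int M + int (row_length lam 0)) (beta mu M)"
  unfolding beta_def lessThan_Suc_eq_insert_0 by (auto simp: assms image_image)

text \<open>Induction on the cardinality: the largest element encodes the top row, the others encode
  the rows beneath it.\<close>

lemma exists_partition_beta:
  assumes "finite A" "card A = M" "\<And>x. x \<in> A \<Longrightarrow> 0 \<le> x"
  shows "\<exists>mu. is_int_partition mu \<and> length mu \<le> M \<and> beta mu M = A"
  using assms
proof (induction M arbitrary: A)
  case 0
  then show ?case by (intro exI[of _ "[]"]) (auto simp: is_int_partition_def beta_def)
next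
  case (Suc M)
  define m where "m = Max A"
  have mA: "m \<in> A" and mx: "\<And>x. x \<in> A \<Longrightarrow> x \<le> m"
    using Suc.prems by (auto simp: m_def intro!: Max_in)
  have "card (A - {m}) = M" using mA Suc.prems by simp
  with Suc.IH[of "A - {m}"] Suc.prems obtain nu where
    nu: "is_int_partition nu" "length nu \<le> M" "beta nu M = A - {m}" by auto
  \<comment> \<open>\<open>Suc M\<close> distinct elements of \<open>{0..m}\<close> force
    \<open>m \<ge> int M\<close>, so \<open>m - int M\<close> can serve as the length of the top
    row.\<close>
  have "A \<subseteq> {0..m}" using mx Suc.prems by auto
  then have "card A \<le> card {0..m}" by (intro card_mono) auto
  then have mM: "int M \<le> m" using Suc.prems by simp
  \<comment> \<open>The element of the first row of \<open>nu\<close> lies in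
    \<open>A - {m}\<close>, hence below the maximum; this makes the new top row at least as long as
    that row.\<close>
  have first: "int M + int (row_length nu 0) - 1 < m" if "nu \<noteq> []"
  proof -
    have "int M + int (row_length nu 0) - 1 \<in> beta nu M"
      unfolding beta_def by (rule image_eqI[of _ _ 0]) (use that nu(2) in \<open>cases nu; simp\<close>)+
    then show ?thesis using nu(3) mx by force
  qed
  show ?case
  proof (cases "m = int M")
    \<comment> \<open>A top row of length 0 cannot be stored in the list; the rows below it are then
      empty too, and \<open>[]\<close> is the witness.\<close>
    case True
    have "nu = []"
    proof (rule ccontr)
      assume "nu \<noteq> []"
      with first True have "row_length nu 0 = 0" by simp
      with \<open>nu \<noteq> []\<close> nu(1) show False
        by (cases nu) (auto simp: is_int_partition_def)
    qed
    then have "beta [] (Suc M) = insert m (A - {m})"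
      using beta_Suc[of "[]" "[]" M] nu(3) True by (simp add: row_length_def)
    with mA show ?thesis by (intro exI[of _ "[]"]) (auto simp: is_int_partition_def)
  next
    case False
    define a where "a = nat (m - int M)"
    have a: "a > 0" "int a = m - int M" using False mM by (auto simp: a_def)
    have "x \<le> a" if "x \<in> set nu" for x
    proof -
      have "x \<le> row_length nu 0"
        using that nu(1) by (cases nu) (auto simp: is_int_partition_def)
      then show ?thesis using first a that by fastforce
    qed
    then have "is_int_partition (a # nu)"
      using nu(1) a by (auto simp: is_int_partition_def)
    moreover have "beta (a # nu) (Suc M) = A"
      using beta_Suc[of "a # nu" nu M] nu(3) mA a by auto
    ultimately show ?thesis using nu(2) by (intro exI[of _ "a # nu"]) auto
  qed
qed

text \<open>Both functions list the same set in decreasing order, so each value is determined by its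
  rank.\<close>

lemma strict_antimono_range_unique:
  fixes f g :: "nat \<Rightarrow> int"
  assumes f: "\<And>r s. r < s \<Longrightarrow> f s < f r" and g: "\<And>r s. r < s \<Longrightarrow> g s < g r"
    and "range f = range g"
  shows "f r = g r"
proof (induction r rule: less_induct)
  case (less r)
  obtain a where a: "f r = g a" using assms(3) by (metis rangeE rangeI)
  obtain b where b: "g r = f b" using assms(3) by (metis rangeE rangeI)
  \<comment> \<open>For \<open>a < r\<close> the induction hypothesis would give
    \<open>f a = g a = f r\<close>, against strictness.\<close>
  have "\<not> a < r" using less[of a] a f[of a r] by auto
  moreover have "\<not> b < r" using less[of b] b g[of b r] by auto
  moreover have "h x \<le> h r" if "\<And>r s. r < s \<Longrightarrow> h s < h r" "\<not> x < r" for h :: "nat \<Rightarrow> int" and x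
    using that(1)[of r x] that(2) by (cases "x = r") auto
  ultimately have "g a \<le> g r" "f b \<le> f r" using f g by blast+
  with a b show ?case by simp
qed

lemma partition_eqI:
  assumes "is_int_partition mu" "is_int_partition nu"
    and "\<And>r. row_length mu r = row_length nu r"
  shows "mu = nu"
proof -
  have pos: "r < length lam \<longleftrightarrow> row_length lam r \<noteq> 0" if "is_int_partition lam" for lam r
    using that unfolding is_int_partition_def row_length_def by (metis nth_mem)
  have "\<And>r. r < length mu \<longleftrightarrow> r < length nu"
    using pos assms by simp
  then have "length mu = length nu" by (metis linorder_neqE_nat less_irrefl)
  then show ?thesis
    using assms(3) unfolding row_length_def by (intro nth_equalityI) (simp, metis)
qed

text \<open>This is the uniqueness behind the definite description in \<open>t_quotient\<close>. The
  edge indices of the rows list the zeros in decreasing order, so sequences agreeing up to a shift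
  agree row by row up to that shift.\<close>

lemma partition_eq_of_zero_one_shift:
  assumes mu: "is_int_partition mu" and nu: "is_int_partition nu"
    and eq: "\<And>j. zero_one mu (j + s) = zero_one nu j"
  shows "mu = nu"
proof -
  define e where "e lam r = int (row_length lam r) - int r - 1" for lam r
  have z: "zero_one lam m = 0 \<longleftrightarrow> m \<in> range (e lam)" for lam m
    by (auto simp: zero_one_def e_def)
  have "range (\<lambda>r. e mu r - s) = range (e nu)"
  proof (rule set_eqI)
    fix x
    have "x \<in> range (\<lambda>r. e mu r - s) \<longleftrightarrow> x + s \<in> range (e mu)"
      by (auto simp: image_iff algebra_simps)
    then show "x \<in> range (\<lambda>r. e mu r - s) \<longleftrightarrow> x \<in> range (e nu)"
      using eq[of x] z by metis
  qed
  then have *: "e mu r - s = e nu r" for r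
    using row_length_strict[OF mu] row_length_strict[OF nu]
    by (intro strict_antimono_range_unique[of "\<lambda>r. e mu r - s" "e nu"]) (auto simp: e_def)
  \<comment> \<open>In a row that is empty for both partitions the two edge indices
    coincide.\<close>
  have "s = 0"
    using *[of "max (length mu) (length nu)"] by (simp add: e_def row_length_beyond)
  then show ?thesis
    using * mu nu by (intro partition_eqI) (auto simp: e_def)
qed

lemma t_quotient_eqI:
  assumes "is_int_partition mu" "\<And>j. zero_one mu (j + s) = zero_one lam (int t * j + int i)"
  shows "t_quotient t lam i = mu"
  unfolding t_quotient_def
proof (rule the_equality)
  fix nu assume "is_int_partition nu \<and>
    (\<exists>s. \<forall>j. zero_one nu (j + s) = zero_one lam (int t * j + int i))"
  then obtain s' where nu: "is_int_partition nu"
    "\<And>j. zero_one nu (j + s') = zero_one lam (int t * j + int i)" by blast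
  have "zero_one nu (j + (s' - s)) = zero_one mu j" for j
    using nu(2)[of "j - s"] assms(2)[of "j - s"] by (simp add: algebra_simps)
  then show "nu = mu" using partition_eq_of_zero_one_shift nu assms by blast
qed (use assms in blast)

section \<open>Hook removal and residue classes\<close>

text \<open>Removing a \<open>t\<close>-hook moves a zero from \<open>i + int t\<close> to
  \<open>i\<close>, within one residue class. Only zeros occur below \<open>L\<close>, so
  \<open>i \<ge> L\<close> and no zero leaves the window.\<close>

lemma remove_hook_residue_card:
  fixes c L :: int
  assumes "(remove_hook t)\<^sup>*\<^sup>* lam mu" and "\<And>m. m < L \<Longrightarrow> zero_one lam m = 0"
  shows "(\<forall>m<L. zero_one mu m = 0) \<and>
    card {m. L \<le> m \<and> m mod int t = c \<and> zero_one mu m = 0} =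
    card {m. L \<le> m \<and> m mod int t = c \<and> zero_one lam m = 0}"
  using assms(1)
proof (induction rule: rtranclp_induct)
  case base
  then show ?case using assms(2) by simp
next
  case (step mu nu)
  obtain i where i: "zero_one mu i = 1" "zero_one mu (i + int t) = 0"
    "zero_one nu = (zero_one mu)(i := 0, i + int t := 1)"
    using step.hyps by (auto simp: remove_hook_def)
  \<comment> \<open>For \<open>t = 0\<close> a single index would carry both values 1 and 0.\<close>
  have t: "t > 0" using i by (cases t) auto
  have iL: "L \<le> i" using i(1) step.IH by (metis linorder_not_less zero_neq_one)
  let ?A = "\<lambda>lam. {m. L \<le> m \<and> m mod int t = c \<and> zero_one lam m = 0}"
  have "card (?A nu) = card (?A mu)"
  proof (cases "i mod int t = c")
    case True
    have "?A nu = insert i (?A mu - {i + int t})"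
      using i iL t True by auto
    moreover have "i + int t \<in> ?A mu" "i \<notin> ?A mu" using i iL True by auto
    \<comment> \<open>If \<open>A\<close> is infinite, both cardinalities are 0.\<close>
    moreover have "card (insert i (A - {b})) = card A" if "b \<in> A" "i \<notin> A" for A and b :: int
    proof (cases "finite A")
      case True
      then show ?thesis
        using that card_Suc_Diff1[OF True that(1)] card_insert_disjoint[of "A - {b}" i] by simp
    qed simp
    ultimately show ?thesis by simp
  next
    case False
    then have "?A nu = ?A mu" using i by auto
    then show ?thesis by simp
  qed
  moreover have "\<forall>m<L. zero_one nu m = 0" using i(3) iL step.IH t by auto
  ultimately show ?case using step.IH by simp
qed

section \<open>Hook lengths and contents as differences of beta numbers\<close>

lemma down_closed_eq_lessThan:
  fixes S :: "nat set"
  assumes "finite S" "\<And>x y. y \<in> S \<Longrightarrow> x < y \<Longrightarrow> x \<in> S"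
  shows "S = {..<card S}"
proof (cases "S = {}")
  case False
  have "S = {..Max S}"
  proof
    show "S \<subseteq> {..Max S}" using assms(1) by auto
    show "{..Max S} \<subseteq> S"
      using assms Max_in[OF assms(1) False] by (auto simp: le_less)
  qed
  then show ?thesis by (metis card_lessThan lessThan_Suc_atMost)
qed simp

lemma sum_young_diagram:
  fixes g :: "nat \<times> nat \<Rightarrow> int"
  assumes "length lam \<le> N"
  shows "(\<Sum>b\<in>young_diagram lam. g b) = (\<Sum>r<N. \<Sum>j<row_length lam r. g (r, j))"
proof -
  have "young_diagram lam = Sigma {..<N} (\<lambda>r. {..<row_length lam r})"
    using assms by (auto simp: young_diagram_def row_length_def split: if_splits)
  then show ?thesis by (simp add: sum.Sigma)
qed

lemma finite_young_diagram [simp]: "finite (young_diagram lam)"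
proof -
  have "young_diagram lam = Sigma {..<length lam} (\<lambda>r. {..<lam ! r})"
    by (auto simp: young_diagram_def)
  then show ?thesis by simp
qed

text \<open>A hook joins the horizontal edge below its column to the vertical edge at the end of its
  row, and its length is the difference of their indices. So the hooks of row \<open>r\<close> match
  the gaps of the beta set below \<open>x\<close>.\<close>

lemma sum_row_hooks:
  fixes F :: "int \<Rightarrow> int"
  assumes part: "is_int_partition lam" and len: "length lam \<le> N" and rN: "r < N"
  defines "x \<equiv> int N + int (row_length lam r) - int r - 1"
  shows "(\<Sum>j<row_length lam r. F (int (hook_length lam (r, j)))) =
    (\<Sum>y\<in>{0..<x} - beta lam N. F (x - y))"
proof -
  define col where "col j = card {i. j < row_length lam i}" for j
  \<comment> \<open>\<open>col\<close> is the conjugate partition: row lengths decrease weakly, so a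
    column occupies an initial segment of the rows.\<close>
  have col: "j < row_length lam i \<longleftrightarrow> i < col j" for i j
  proof -
    have "{i. j < row_length lam i} \<subseteq> {..<length lam}"
      by (auto simp: row_length_def split: if_splits)
    then have "finite {i. j < row_length lam i}" by (rule finite_subset) simp
    then have "{i. j < row_length lam i} = {..<col j}"
      unfolding col_def
      by (rule down_closed_eq_lessThan)
        (use row_length_antimono[OF part] in \<open>auto intro: less_le_trans\<close>)
    then show ?thesis by blast
  qed
  have colN: "col j \<le> N" for j
    using col[of j "N"] row_length_beyond[OF len] by (simp add: not_less)
  have col_anti: "col j' \<le> col j" if "j \<le> j'" for j j'
    using col[of j "col j"] col[of j' "col j"] that by auto
  \<comment> \<open>the shifted index of the horizontal edge below column \<open>j\<close>\<close>
  define y where "y j = int N + int j - int (col j)" for j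
  have y_mono: "y j < y j'" if "j < j'" for j j'
    using col_anti[of j j'] that by (simp add: y_def)
  have inj: "inj_on y {..<row_length lam r}"
    by (rule inj_onI) (metis y_mono linorder_neqE_nat less_irrefl)
  \<comment> \<open>Equality with the element of row \<open>s\<close> would mean
    \<open>row_length lam s + col j = s + j + 1\<close>; the left side is at least
    \<open>s + j + 2\<close> if \<open>(s, j)\<close> is a box and at most \<open>s + j\<close>
    otherwise.\<close>
  have y_notin: "y j \<notin> beta lam N" for j
  proof
    assume "y j \<in> beta lam N"
    then obtain s where "y j = int N + int (row_length lam s) - int s - 1"
      by (auto simp: beta_def)
    with col[of j s] show False by (auto simp: y_def)
  qed
  have yx: "y j < x" if "j < row_length lam r" for j
    using col[of j r] that by (auto simp: y_def x_def)
  \<comment> \<open>The elements below \<open>x\<close> belong to the rows under row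
    \<open>r\<close>. Counting them leaves \<open>row_length lam r\<close> gaps, so the injection
    \<open>y\<close> into the gaps is onto.\<close>
  have "beta lam N \<inter> {0..<x} =
    (\<lambda>r. int N + int (row_length lam r) - int r - 1) ` {r<..<N}"
  proof (intro equalityI subsetI)
    fix z assume z: "z \<in> beta lam N \<inter> {0..<x}"
    then obtain s where s: "s < N" "z = int N + int (row_length lam s) - int s - 1"
      by (auto simp: beta_def)
    have "r < s"
      using z s row_length_strict[OF part, of s r] by (cases s r rule: linorder_cases) (auto simp: x_def)
    with s show "z \<in> (\<lambda>r. int N + int (row_length lam r) - int r - 1) ` {r<..<N}" by auto
  next
    fix z assume "z \<in> (\<lambda>r. int N + int (row_length lam r) - int r - 1) ` {r<..<N}"
    then show "z \<in> beta lam N \<inter> {0..<x}"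
      using row_length_strict[OF part, of r] by (fastforce simp: beta_def x_def)
  qed
  then have "card (beta lam N \<inter> {0..<x}) = N - r - 1"
    by (simp add: card_image[OF inj_on_beta[OF part]])
  then have card: "card ({0..<x} - beta lam N) = row_length lam r"
    using card_Diff_subset_Int[of "{0..<x}" "beta lam N"] rN
    by (simp add: Int_commute) (simp add: x_def)
  have "y ` {..<row_length lam r} \<subseteq> {0..<x} - beta lam N"
    using y_notin yx colN by (auto simp: y_def) (smt (verit) colN of_nat_mono of_nat_0_le_iff)
  then have img: "y ` {..<row_length lam r} = {0..<x} - beta lam N"
    using card card_image[OF inj] by (intro card_subset_eq) auto
  \<comment> \<open>Arm \<open>row_length lam r - j - 1\<close>, leg \<open>col j - r - 1\<close>
    and the box itself add up to \<open>x - y j\<close>.\<close>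
  have hook: "int (hook_length lam (r, j)) = x - y j" if j: "j < row_length lam r" for j
  proof -
    have "r < length lam" using j by (auto simp: row_length_def split: if_splits)
    then have 1: "{j'. j < j' \<and> (r, j') \<in> young_diagram lam} = {j<..<row_length lam r}"
      by (auto simp: young_diagram_def row_length_def)
    have "(i', j) \<in> young_diagram lam \<longleftrightarrow> j < row_length lam i'" for i'
      by (auto simp: young_diagram_def row_length_def)
    then have 2: "{i'. r < i' \<and> (i', j) \<in> young_diagram lam} = {r<..<col j}"
      using col by auto
    show ?thesis
      using j col[of j r] unfolding hook_length_def fst_conv snd_conv 1 2
      by (simp add: x_def y_def of_nat_diff)
  qed
  have "(\<Sum>j<row_length lam r. F (int (hook_length lam (r, j)))) =
      (\<Sum>j<row_length lam r. F (x - y j))" by (simp add: hook)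
  also have "\<dots> = (\<Sum>z\<in>y ` {..<row_length lam r}. F (x - z))"
    by (simp add: sum.reindex[OF inj])
  finally show ?thesis by (simp only: img)
qed

text \<open>Exchanging the variables maps the pairs with \<open>y < x\<close> to those with
  \<open>x < y\<close>, and the diagonal contributes \<open>F 0 = 0\<close>.\<close>

lemma sum_even_function_differences:
  fixes F :: "int \<Rightarrow> int"
  assumes "finite A" "\<And>x. F (- x) = F x" "F 0 = 0"
  shows "2 * (\<Sum>x\<in>A. \<Sum>y\<in>{y\<in>A. y < x}. F (x - y)) = (\<Sum>x\<in>A. \<Sum>y\<in>A. F (x - y))"
proof -
  have ind: "(\<Sum>y\<in>{y\<in>A. P y}. g y) = (\<Sum>y\<in>A. if P y then g y else 0)" for P and g :: "int \<Rightarrow> int"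
    using assms(1) by (simp add: sum.inter_filter)
  have "(\<Sum>x\<in>A. \<Sum>y\<in>A. if y < x then F (x - y) else 0)
      = (\<Sum>x\<in>A. \<Sum>y\<in>A. if x < y then F (x - y) else 0)"
    by (subst sum.swap) (intro sum.cong refl, metis assms(2) minus_diff_eq)
  then have "2 * (\<Sum>x\<in>A. \<Sum>y\<in>{y\<in>A. y < x}. F (x - y)) =
      (\<Sum>x\<in>A. \<Sum>y\<in>A. (if y < x then F (x - y) else 0) + (if x < y then F (x - y) else 0))"
    by (simp add: ind sum.distrib)
  also have "\<dots> = (\<Sum>x\<in>A. \<Sum>y\<in>A. F (x - y))"
    by (intro sum.cong refl) (use assms(3) in \<open>auto simp: linorder_neq_iff\<close>)
  finally show ?thesis .
qed

text \<open>Each row contributes the differences of its element with all of \<open>Y\<close>, less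
  those with smaller elements inside \<open>X\<close> and inside \<open>Y\<close>. Doubling turns
  the sums over ordered pairs into full double sums.\<close>

lemma hook_content_double_sum:
  fixes F :: "int \<Rightarrow> int"
  assumes part: "is_int_partition lam" and len: "length lam \<le> N"
    and even: "\<And>x. F (- x) = F x" and F0: "F 0 = 0"
  defines "X \<equiv> beta lam N" and "Y \<equiv> {0..<int N}"
  shows "2 * ((\<Sum>b\<in>young_diagram lam. F (int (hook_length lam b)))
      - (\<Sum>b\<in>young_diagram lam. F (box_content b))) =
    (\<Sum>x\<in>X. \<Sum>y\<in>Y. F (x - y)) + (\<Sum>x\<in>Y. \<Sum>y\<in>X. F (x - y))
    - (\<Sum>x\<in>X. \<Sum>y\<in>X. F (x - y)) - (\<Sum>x\<in>Y. \<Sum>y\<in>Y. F (x - y))"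
proof -
  define p where "p r = int N + int (row_length lam r) - int r - 1" for r
  \<comment> \<open>Every sum is rewritten as a sum of \<open>F d\<close> over an interval of
    differences \<open>d\<close>; evenness of \<open>F\<close> puts the pairs within
    \<open>Y\<close> on the negative side.\<close>
  have row: "(\<Sum>j<row_length lam r. F (int (hook_length lam (r, j))))
      - (\<Sum>j<row_length lam r. F (box_content (r, j)))
    = (\<Sum>y\<in>Y. F (p r - y)) - (\<Sum>y\<in>{y\<in>X. y < p r}. F (p r - y))
      - (\<Sum>y\<in>{y\<in>Y. y < int r}. F (int r - y))" if "r < N" for r
  proof -
    have p0: "0 \<le> p r" using that by (simp add: p_def)
    have h: "(\<Sum>j<row_length lam r. F (int (hook_length lam (r, j)))) =
      (\<Sum>y\<in>{0..<p r}. F (p r - y)) - (\<Sum>y\<in>{y\<in>X. y < p r}. F (p r - y))"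
    proof -
      have "{0..<p r} \<inter> X = {y\<in>X. y < p r}"
        using beta_nonneg[of _ lam N] by (auto simp: X_def)
      then have "(\<Sum>y\<in>{0..<p r}. F (p r - y)) =
          (\<Sum>y\<in>{0..<p r} - X. F (p r - y)) + (\<Sum>y\<in>{y\<in>X. y < p r}. F (p r - y))"
        using sum.Int_Diff[of "{0..<p r}" "\<lambda>y. F (p r - y)" X] by simp
      then show ?thesis
        using sum_row_hooks[OF part len that, of F] by (simp add: p_def X_def)
    qed
    have a: "(\<Sum>y\<in>{0..<p r}. F (p r - y)) = (\<Sum>d\<in>{1..p r}. F d)"
      by (rule sum.reindex_bij_witness[of _ "\<lambda>d. p r - d" "\<lambda>y. p r - y"]) auto
    have b: "(\<Sum>y\<in>Y. F (p r - y)) = (\<Sum>d\<in>{int (row_length lam r) - int r..p r}. F d)"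
      by (rule sum.reindex_bij_witness[of _ "\<lambda>d. p r - d" "\<lambda>y. p r - y"]) (auto simp: p_def Y_def)
    have c: "(\<Sum>j<row_length lam r. F (box_content (r, j))) =
        (\<Sum>d\<in>{- int r..<int (row_length lam r) - int r}. F d)"
      by (rule sum.reindex_bij_witness[of _ "\<lambda>d. nat (d + int r)" "\<lambda>j. int j - int r"])
        (auto simp: box_content_def)
    have d: "(\<Sum>y\<in>{y\<in>Y. y < int r}. F (int r - y)) = (\<Sum>d\<in>{- int r..<0}. F d)"
      using that even
      by (intro sum.reindex_bij_witness[of _ "\<lambda>d. d + int r" "\<lambda>y. y - int r"])
        (auto simp: Y_def, metis minus_diff_eq)
    \<comment> \<open>The interval from \<open>- int r\<close> to \<open>p r\<close> is cut in two
      ways: here where the contents of the row end, and below at 0, where \<open>F\<close>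
      vanishes.\<close>
    have e: "(\<Sum>d\<in>{- int r..p r}. F d) =
        (\<Sum>d\<in>{- int r..<int (row_length lam r) - int r}. F d)
        + (\<Sum>d\<in>{int (row_length lam r) - int r..p r}. F d)"
      using that by (subst sum.union_disjoint[symmetric]) (auto simp: p_def intro!: sum.cong)
    have "{- int r..p r} = insert 0 ({- int r..<0} \<union> {1..p r})"
      using p0 by auto
    then have f: "(\<Sum>d\<in>{- int r..p r}. F d) = (\<Sum>d\<in>{- int r..<0}. F d) + (\<Sum>d\<in>{1..p r}. F d)"
      using sum.union_disjoint[of "{- int r..<0}" "{1..p r}" F] by (simp add: F0 disjoint_iff)
    show ?thesis using h a b c d e f by simp
  qed
  have "(\<Sum>b\<in>young_diagram lam. F (int (hook_length lam b)))
      - (\<Sum>b\<in>young_diagram lam. F (box_content b)) =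
    (\<Sum>r<N. (\<Sum>j<row_length lam r. F (int (hook_length lam (r, j))))
      - (\<Sum>j<row_length lam r. F (box_content (r, j))))"
    by (simp add: sum_young_diagram[OF len] sum_subtractf)
  \<comment> \<open>The index \<open>r\<close> stands for the element \<open>p r\<close> of
    \<open>X\<close> in the first two sums and for the element \<open>int r\<close> of
    \<open>Y\<close> in the last.\<close>
  also have "\<dots> = (\<Sum>x\<in>X. \<Sum>y\<in>Y. F (x - y)) - (\<Sum>x\<in>X. \<Sum>y\<in>{y\<in>X. y < x}. F (x - y))
      - (\<Sum>x\<in>Y. \<Sum>y\<in>{y\<in>Y. y < x}. F (x - y))"
    by (simp add: row sum_subtractf)
      (simp add: X_def sum_beta[OF part] p_def Y_def sum_lessThan_int)
  finally have 1: "(\<Sum>b\<in>young_diagram lam. F (int (hook_length lam b)))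
      - (\<Sum>b\<in>young_diagram lam. F (box_content b)) = \<dots>" .
  have "(\<Sum>x\<in>Y. \<Sum>y\<in>X. F (x - y)) = (\<Sum>x\<in>X. \<Sum>y\<in>Y. F (x - y))"
    using even[of "x - y" for x y] by (subst sum.swap) simp
  moreover have fin: "finite X" "finite Y" by (simp_all add: X_def Y_def)
  moreover have "2 * (a - b) = c + c' - d - e"
    if "c' = c" "a - b = c - u - v" "2 * u = d" "2 * v = e" for a b c c' d e u v :: int
    using that by simp
  ultimately show ?thesis
    using 1 sum_even_function_differences[OF fin(1) even F0]
      sum_even_function_differences[OF fin(2) even F0]
    by blast
qed

section \<open>Double sums split by residue classes\<close>

lemma sum_mod_classes:
  fixes g :: "int \<Rightarrow> int"
  assumes "t > 0" "finite A"
  shows "(\<Sum>x\<in>A. g x) = (\<Sum>i<t. \<Sum>x\<in>{x\<in>A. x mod int t = int i}. g x)"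
proof -
  have *: "(\<Sum>x\<in>A. g x) = (\<Sum>c\<in>{0..<int t}. \<Sum>x\<in>{x\<in>A. x mod int t = c}. g x)"
    using assms by (intro sum.group[symmetric]) auto
  show ?thesis unfolding * sum_lessThan_int by simp
qed

lemma sum_square_differences:
  fixes A B :: "int set"
  assumes "finite A" "finite B"
  shows "(\<Sum>x\<in>A. \<Sum>y\<in>B. (x - y)\<^sup>2) =
    int (card B) * (\<Sum>x\<in>A. x\<^sup>2) + int (card A) * (\<Sum>y\<in>B. y\<^sup>2) - 2 * \<Sum>A * \<Sum>B"
proof -
  have "(\<Sum>x\<in>A. \<Sum>y\<in>B. 2 * (x * y)) = 2 * (\<Sum>x\<in>A. \<Sum>y\<in>B. x * y)"
    by (simp add: sum_distrib_left)
  also have "\<dots> = 2 * (\<Sum>A * \<Sum>B)" by (simp only: sum_product)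
  finally show ?thesis
    by (simp add: power2_diff sum.distrib sum_subtractf sum_distrib_left[symmetric] mult.assoc)
qed

text \<open>A periodic weight of the difference is constant on each pair of residue classes.\<close>

lemma double_sum_periodic_squares:
  fixes w :: "int \<Rightarrow> int"
  assumes t: "t > 0" and fin: "finite A" "finite B" and w: "\<And>x. w (x mod int t) = w x"
  shows "(\<Sum>x\<in>A. \<Sum>y\<in>B. (x - y)\<^sup>2 * w (x - y)) =
    (\<Sum>i<t. \<Sum>j<t. w (int i - int j) *
      (\<Sum>x\<in>{x\<in>A. x mod int t = int i}. \<Sum>y\<in>{y\<in>B. y mod int t = int j}. (x - y)\<^sup>2))"
proof -
  have wij: "w (x - y) = w (int i - int j)" if "x mod int t = int i" "y mod int t = int j" for x y i j
    using w[of "x - y"] w[of "int i - int j"] that by (metis mod_diff_eq)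
  have "(\<Sum>x\<in>A. \<Sum>y\<in>B. (x - y)\<^sup>2 * w (x - y)) =
    (\<Sum>i<t. \<Sum>x\<in>{x\<in>A. x mod int t = int i}. \<Sum>j<t. \<Sum>y\<in>{y\<in>B. y mod int t = int j}.
      (x - y)\<^sup>2 * w (x - y))"
    by (simp only: sum_mod_classes[OF t fin(1)] sum_mod_classes[OF t fin(2)])
  also have "\<dots> = (\<Sum>i<t. \<Sum>j<t. \<Sum>x\<in>{x\<in>A. x mod int t = int i}. \<Sum>y\<in>{y\<in>B. y mod int t = int j}.
      (x - y)\<^sup>2 * w (x - y))"
    by (intro sum.cong refl sum.swap)
  also have "\<dots> = (\<Sum>i<t. \<Sum>j<t. w (int i - int j) *
      (\<Sum>x\<in>{x\<in>A. x mod int t = int i}. \<Sum>y\<in>{y\<in>B. y mod int t = int j}. (x - y)\<^sup>2))"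
    unfolding sum_distrib_left
    by (intro sum.cong refl) (auto simp: mult.commute intro: wij)
  finally show ?thesis .
qed

text \<open>Each \<open>j\<close> has exactly one partner \<open>i = (j + k) mod t\<close>. The
  first sum on the right collects the \<open>j\<close> without wrap-around; in the second the index
  is the wrapped partner \<open>j + k - t\<close>.\<close>

lemma sum_congruent_pairs:
  fixes n :: "nat \<Rightarrow> int"
  assumes "k < t"
  shows "(\<Sum>i<t. \<Sum>j<t. of_bool [int i - int j = int k] (mod int t) * (n i * n j)) =
    (\<Sum>i<t - k. n i * n (i + k)) + (\<Sum>i<k. n i * n (i + t - k))"
proof -
  have c: "[int i - int j = int k] (mod int t) \<longleftrightarrow> i = (j + k) mod t" if "i < t" for i j
  proof -
    have "[int i - int j = int k] (mod int t) \<longleftrightarrow> [int i = int (j + k)] (mod int t)"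
      by (metis (no_types, opaque_lifting) add.commute cong_add_lcancel diff_add_cancel of_nat_add)
    also have "\<dots> \<longleftrightarrow> i = (j + k) mod t"
      using that unfolding cong_int_iff by (simp add: cong_def)
    finally show ?thesis .
  qed
  have "(\<Sum>i<t. \<Sum>j<t. of_bool [int i - int j = int k] (mod int t) * (n i * n j)) =
    (\<Sum>j<t. \<Sum>i<t. if i = (j + k) mod t then n i * n j else 0)"
    by (subst sum.swap) (intro sum.cong refl, simp add: c)
  also have "\<dots> = (\<Sum>j<t. n j * n ((j + k) mod t))"
    using assms by (simp add: sum.delta mult.commute)
  also have "\<dots> = (\<Sum>j<t - k. n j * n ((j + k) mod t)) + (\<Sum>j\<in>{t - k..<t}. n j * n ((j + k) mod t))"
    by (subst sum.union_disjoint[symmetric]) (auto intro!: sum.cong)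
  also have "(\<Sum>j<t - k. n j * n ((j + k) mod t)) = (\<Sum>j<t - k. n j * n (j + k))"
    by (intro sum.cong) auto
  also have "(\<Sum>j\<in>{t - k..<t}. n j * n ((j + k) mod t)) = (\<Sum>i<k. n i * n (i + t - k))"
    using assms
    by (intro sum.reindex_bij_witness[of _ "\<lambda>i. i + t - k" "\<lambda>j. j + k - t"])
      (auto simp: mod_if mult.commute)
  finally show ?thesis .
qed

section \<open>Residue classes of a beta set and the quotients\<close>

lemma beta_Nil: "beta [] N = {0..<int N}"
proof -
  have "x \<in> beta [] N" if "0 \<le> x" "x < int N" for x
    using that by (auto simp: beta_def row_length_def intro!: image_eqI[of _ _ "nat (int N - x - 1)"])
  then show ?thesis by (auto simp: beta_def row_length_def)
qed

text \<open>The shift between indices and beta numbers is a multiple of \<open>t\<close>, so it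
  preserves residues.\<close>

lemma card_residue_zero_one:
  assumes "length lam \<le> t * M"
  shows "card {m. - int (t * M) \<le> m \<and> m mod int t = c \<and> zero_one lam m = 0} =
    card {x \<in> beta lam (t * M). x mod int t = c}"
proof (rule bij_betw_same_card)
  have mod_diff: "(x - int t * int M) mod int t = x mod int t" for x
    using mod_mult_self2[of x "int t" "- int M"] by simp
  show "bij_betw (\<lambda>m. m + int (t * M))
    {m. - int (t * M) \<le> m \<and> m mod int t = c \<and> zero_one lam m = 0}
    {x \<in> beta lam (t * M). x mod int t = c}"
    using zero_one_eq_0_iff[OF assms] beta_nonneg[of _ lam "t * M"] mod_diff
    by (intro bij_betw_byWitness[where f' = "\<lambda>x. x - int (t * M)"]) auto
qed

lemma residue_class_eq_image:
  fixes B :: "int set"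
  assumes "i < t"
  shows "{x \<in> B. x mod int t = int i} = (\<lambda>a. int t * a + int i) ` {a. int t * a + int i \<in> B}"
proof (intro equalityI subsetI)
  fix x assume x: "x \<in> {x \<in> B. x mod int t = int i}"
  then have "x = int t * (x div int t) + int i"
    using mult_div_mod_eq[of "int t" x] by simp
  with x show "x \<in> (\<lambda>a. int t * a + int i) ` {a. int t * a + int i \<in> B}" by auto
qed (use assms in auto)

lemma residue_class_sum:
  fixes B :: "int set"
  assumes "i < t"
  defines "A \<equiv> {a. int t * a + int i \<in> B}"
  shows "card {x \<in> B. x mod int t = int i} = card A"
    and "\<Sum>{x \<in> B. x mod int t = int i} = int t * \<Sum>A + int (card A) * int i"
proof -
  have inj: "inj_on (\<lambda>a. int t * a + int i) A"
    using assms by (auto simp: inj_on_def)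
  show "card {x \<in> B. x mod int t = int i} = card A"
    unfolding residue_class_eq_image[OF assms(1)] A_def[symmetric] by (rule card_image[OF inj])
  show "\<Sum>{x \<in> B. x mod int t = int i} = int t * \<Sum>A + int (card A) * int i"
    unfolding residue_class_eq_image[OF assms(1)] A_def[symmetric]
    by (simp add: sum.reindex[OF inj] sum.distrib sum_distrib_left)
qed

lemma residue_less_multiple_iff:
  fixes a b :: int
  assumes "i < t"
  shows "int t * a + int i < int t * b \<longleftrightarrow> a < b"
proof
  assume "int t * a + int i < int t * b"
  then have "int t * a < int t * b" by simp
  then show "a < b" using assms by simp
next
  assume "a < b"
  then have "int t * (a + 1) \<le> int t * b" by (intro mult_left_mono) auto
  then show "int t * a + int i < int t * b" using assms by (simp add: algebra_simps)
qed

lemma residue_class_interval: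
  assumes "i < t"
  shows "{a. int t * a + int i \<in> {0..<int (t * M)}} = {0..<int M}"
proof -
  have "0 \<le> int t * a + int i \<longleftrightarrow> 0 \<le> a" for a
    using residue_less_multiple_iff[OF assms, of a 0] by linarith
  moreover have "int t * a + int i < int (t * M) \<longleftrightarrow> a < int M" for a
    using residue_less_multiple_iff[OF assms, of a "int M"] by simp
  ultimately show ?thesis by auto
qed

text \<open>Dividing the class by \<open>t\<close> gives a set of \<open>M\<close> numbers, the beta
  set of the quotient. Passing back to the class multiplies the moment by \<open>t\<close> and adds
  \<open>M * i\<close>, which occurs for the empty partition as well.\<close>

lemma sum_residue_class_beta:
  assumes len: "length lam \<le> t * M" and i: "i < t"
    and card: "card {x \<in> beta lam (t * M). x mod int t = int i} = M"
  shows "\<Sum>{x \<in> beta lam (t * M). x mod int t = int i} =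
    int t * int (sum_list (t_quotient t lam i)) + \<Sum>{x \<in> {0..<int (t * M)}. x mod int t = int i}"
proof -
  define A where "A = {a. int t * a + int i \<in> beta lam (t * M)}"
  have cA: "card A = M" using card residue_class_sum(1)[OF i] by (simp add: A_def)
  have nonneg: "0 \<le> a" if "a \<in> A" for a
    using that beta_nonneg[of "int t * a + int i"] residue_less_multiple_iff[OF i, of a 0]
    by (force simp: A_def)
  have inj: "inj_on (\<lambda>a. int t * a + int i) A"
    using i by (auto simp: inj_on_def)
  have "finite A"
    by (rule inj_on_finite[OF inj, of "beta lam (t * M)"]) (auto simp: A_def)
  with exists_partition_beta[of A M] cA nonneg obtain mu where
    mu: "is_int_partition mu" "length mu \<le> M" "beta mu M = A" by auto
  \<comment> \<open>Since the class has exactly \<open>M\<close> elements, the cuts at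
    \<open>- int M\<close> and \<open>- int (t * M)\<close> correspond and the quotient needs no
    shift.\<close>
  have "zero_one mu j = zero_one lam (int t * j + int i)" for j
  proof -
    have "j < - int M \<longleftrightarrow> int t * j + int i < - int (t * M)"
      using residue_less_multiple_iff[OF i, of j "- int M"] by simp
    then have "zero_one mu j = 0 \<longleftrightarrow> zero_one lam (int t * j + int i) = 0"
      unfolding zero_one_eq_0_iff[OF mu(2)] zero_one_eq_0_iff[OF len] mu(3)
      by (simp add: A_def algebra_simps)
    then show ?thesis by (auto simp: zero_one_def split: if_splits)
  qed
  then have q: "t_quotient t lam i = mu"
    using mu(1) by (intro t_quotient_eqI[where s = 0]) simp_all
  show ?thesis
    using sum_beta_eq_size[OF mu(1,2)] cA
    unfolding residue_class_sum(2)[OF i] residue_class_interval[OF i] A_def[symmetric] q mu(3)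
    by (simp add: algebra_simps)
qed

section \<open>The identity for an empty \<open>t\<close>-core\<close>

theorem theorem1p4:
  fixes t k :: nat and lam :: "nat list"
  assumes "t > 0" and "k \<le> t - 1"
    and "is_int_partition lam"
    and "is_t_core_of t [] lam"
  shows
    "(\<Sum>b\<in>{b \<in> young_diagram lam. [int (hook_length lam b) = int k] (mod int t)}.
        (int (hook_length lam b))\<^sup>2)
     + (\<Sum>b\<in>{b \<in> young_diagram lam. [int (hook_length lam b) = int t - int k] (mod int t)}.
        (int (hook_length lam b))\<^sup>2)
     - ((\<Sum>b\<in>{b \<in> young_diagram lam. [box_content b = int k] (mod int t)}. (box_content b)\<^sup>2)
        + (\<Sum>b\<in>{b \<in> young_diagram lam. [box_content b = int t - int k] (mod int t)}. (box_content b)\<^sup>2))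
     = 2 * (int t)\<^sup>2 *
       ((\<Sum>i<t - k. int (sum_list (t_quotient t lam i)) * int (sum_list (t_quotient t lam (i + k))))
        + (\<Sum>i<k. int (sum_list (t_quotient t lam i)) * int (sum_list (t_quotient t lam (i + t - k)))))"
proof -
  \<comment> \<open>The two indicators are added, so \<open>w\<close> is 2 where both congruences
    hold, just as both sums of the statement count such a box.\<close>
  define w :: "int \<Rightarrow> int" where
    "w x = of_bool [x = int k] (mod int t) + of_bool [x = - int k] (mod int t)" for x
  define F where "F x = x\<^sup>2 * w x" for x
  define M where "M = length lam"
  define n where "n i = int (sum_list (t_quotient t lam i))" for i
  define X where "X = beta lam (t * M)"
  define Y where "Y = {0..<int (t * M)}"
  define cls where "cls A i = {x \<in> A. x mod int t = int i}" for A :: "int set" and i :: nat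
  define Q where "Q A i = (\<Sum>x\<in>cls A i. x\<^sup>2)" for A i
  have fin: "finite X" "finite Y" by (simp_all add: X_def Y_def)
  have len: "length lam \<le> t * M" using assms(1) by (simp add: M_def)

  have "[- x = int k] (mod int t) \<longleftrightarrow> [x = - int k] (mod int t)" for x
    using cong_minus_minus_iff[of x "- int k" "int t"] by simp
  moreover have "[- x = - int k] (mod int t) \<longleftrightarrow> [x = int k] (mod int t)" for x
    by (rule cong_minus_minus_iff)
  ultimately have w_even: "w (- x) = w x" for x by (simp add: w_def)
  have w_mod: "w (x mod int t) = w x" for x by (simp add: w_def cong_def)
  have cong_t: "[x = int t - int k] (mod int t) \<longleftrightarrow> [x = - int k] (mod int t)" for x
    using mod_add_self1[of "int t" "- int k"] by (simp add: cong_def)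
  have F_sum: "(\<Sum>b\<in>{b \<in> young_diagram lam. [f b = int k] (mod int t)}. (f b)\<^sup>2)
      + (\<Sum>b\<in>{b \<in> young_diagram lam. [f b = int t - int k] (mod int t)}. (f b)\<^sup>2)
    = (\<Sum>b\<in>young_diagram lam. F (f b))" for f
    unfolding cong_t sum.inter_filter[OF finite_young_diagram] sum.distrib[symmetric]
    by (intro sum.cong refl) (simp add: F_def w_def)

  have card_Y: "card (cls Y i) = M" if "i < t" for i
    using residue_class_sum(1)[OF that, of Y] residue_class_interval[OF that, of M]
    by (simp add: cls_def Y_def)
  have card_X: "card (cls X i) = M" if "i < t" for i
  proof -
    \<comment> \<open>The zeros per class are compared with those of the core \<open>[]\<close>,
      whose classes have \<open>M\<close> elements each.\<close>
    have "card {m. - int (t * M) \<le> m \<and> m mod int t = int i \<and> zero_one [] m = 0} =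
      card {m. - int (t * M) \<le> m \<and> m mod int t = int i \<and> zero_one lam m = 0}"
      using assms(4) zero_one_eq_0_iff[OF len]
      by (intro conjunct2[OF remove_hook_residue_card]) (auto simp: is_t_core_of_def)
    then show ?thesis
      using card_Y[OF that] card_residue_zero_one[OF len] card_residue_zero_one[of "[]" t M]
      by (simp add: cls_def X_def Y_def beta_Nil)
  qed
  have P: "\<Sum>(cls X i) = int t * n i + \<Sum>(cls Y i)" if "i < t" for i
    using sum_residue_class_beta[OF len that] card_X[OF that]
    by (simp add: cls_def X_def Y_def n_def)

  \<comment> \<open>As all classes have \<open>M\<close> elements, the coefficients of the square
    sums \<open>Q\<close> are the same for all \<open>i\<close> and \<open>j\<close>.\<close>
  have D: "(\<Sum>x\<in>A. \<Sum>y\<in>B. F (x - y)) = (\<Sum>i<t. \<Sum>j<t. w (int i - int j) *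
      (int M * Q A i + int M * Q B j - 2 * \<Sum>(cls A i) * \<Sum>(cls B j)))"
    if "A \<in> {X, Y}" "B \<in> {X, Y}" for A B
  proof -
    have fAB: "finite A" "finite B" using that fin by auto
    have "(\<Sum>x\<in>A. \<Sum>y\<in>B. F (x - y)) = (\<Sum>i<t. \<Sum>j<t. w (int i - int j) *
        (\<Sum>x\<in>cls A i. \<Sum>y\<in>cls B j. (x - y)\<^sup>2))"
      unfolding F_def cls_def using double_sum_periodic_squares[of t A B w] assms(1) fAB w_mod by blast
    also have "\<dots> = (\<Sum>i<t. \<Sum>j<t. w (int i - int j) *
      (int M * Q A i + int M * Q B j - 2 * \<Sum>(cls A i) * \<Sum>(cls B j)))"
    proof (intro sum.cong refl arg_cong2[where f = times])
      fix i j assume ij: "i \<in> {..<t}" "j \<in> {..<t}"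
      then have "card (cls A i) = M" "card (cls B j) = M"
        using that card_X card_Y by auto
      moreover have "finite (cls A i)" "finite (cls B j)" using fAB by (simp_all add: cls_def)
      ultimately show "(\<Sum>x\<in>cls A i. \<Sum>y\<in>cls B j. (x - y)\<^sup>2) =
          int M * Q A i + int M * Q B j - 2 * \<Sum>(cls A i) * \<Sum>(cls B j)"
        by (simp add: sum_square_differences Q_def)
    qed
    finally show ?thesis .
  qed

  have "2 * ((\<Sum>b\<in>young_diagram lam. F (int (hook_length lam b)))
      - (\<Sum>b\<in>young_diagram lam. F (box_content b))) =
    (\<Sum>x\<in>X. \<Sum>y\<in>Y. F (x - y)) + (\<Sum>x\<in>Y. \<Sum>y\<in>X. F (x - y))
    - (\<Sum>x\<in>X. \<Sum>y\<in>X. F (x - y)) - (\<Sum>x\<in>Y. \<Sum>y\<in>Y. F (x - y))"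
    unfolding X_def Y_def
    by (rule hook_content_double_sum[OF assms(3) len]) (simp_all add: F_def w_even)
  also have "\<dots> = (\<Sum>i<t. \<Sum>j<t. 2 * (int t)\<^sup>2 * (w (int i - int j) * (n i * n j)))"
  proof -
    \<comment> \<open>The \<open>Q\<close> terms cancel, and the mixed terms factor into twice the
      product of the moment differences \<open>int t * n i\<close> and
      \<open>int t * n j\<close>.\<close>
    have "w (int i - int j) *
        (int M * Q X i + int M * Q Y j - 2 * \<Sum>(cls X i) * \<Sum>(cls Y j))
      + w (int i - int j) *
        (int M * Q Y i + int M * Q X j - 2 * \<Sum>(cls Y i) * \<Sum>(cls X j))
      - w (int i - int j) *
        (int M * Q X i + int M * Q X j - 2 * \<Sum>(cls X i) * \<Sum>(cls X j))
      - w (int i - int j) *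
        (int M * Q Y i + int M * Q Y j - 2 * \<Sum>(cls Y i) * \<Sum>(cls Y j))
      = 2 * (int t)\<^sup>2 * (w (int i - int j) * (n i * n j))" if "i < t" "j < t" for i j
      unfolding P[OF that(1)] P[OF that(2)] by algebra
    then show ?thesis
      unfolding D[of X Y, simplified] D[of Y X, simplified] D[of X X, simplified] D[of Y Y, simplified]
        sum.distrib[symmetric] sum_subtractf[symmetric]
      by (intro sum.cong refl) simp
  qed
  also have "\<dots> = 2 * ((int t)\<^sup>2 * (\<Sum>i<t. \<Sum>j<t. w (int i - int j) * (n i * n j)))"
    by (simp add: sum_distrib_left mult.assoc)
  finally have main: "(\<Sum>b\<in>young_diagram lam. F (int (hook_length lam b)))
      - (\<Sum>b\<in>young_diagram lam. F (box_content b)) =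
    (int t)\<^sup>2 * (\<Sum>i<t. \<Sum>j<t. w (int i - int j) * (n i * n j))" by simp

  let ?T = "\<Sum>i<t. \<Sum>j<t. of_bool [int i - int j = int k] (mod int t) * (n i * n j)"
  \<comment> \<open>Exchanging \<open>i\<close> and \<open>j\<close> turns the residue
    \<open>- k\<close> into \<open>k\<close>, so both halves of \<open>w\<close> contribute
    equally.\<close>
  have "[int i - int j = - int k] (mod int t) \<longleftrightarrow> [int j - int i = int k] (mod int t)" for i j
    using cong_minus_minus_iff[of "int j - int i" "int k" "int t"] by simp
  then have "(\<Sum>i<t. \<Sum>j<t. of_bool [int i - int j = - int k] (mod int t) * (n i * n j)) = ?T"
    by (subst sum.swap) (simp add: mult.commute[of "n _" "n _"])
  then have "(\<Sum>i<t. \<Sum>j<t. w (int i - int j) * (n i * n j)) = 2 * ?T"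
    by (simp add: w_def distrib_right sum.distrib)
  also have "?T = (\<Sum>i<t - k. n i * n (i + k)) + (\<Sum>i<k. n i * n (i + t - k))"
    using assms by (intro sum_congruent_pairs) simp
  finally show ?thesis
    using main unfolding F_sum n_def by (simp add: algebra_simps)
qed

end
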